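(* Let $x=(x_n)_{n\in\mathbb{N}}$ and $y=(y_n)_{n\in\mathbb{N}}$ be two elements of $\ell_\infty$ over $\mathbb{K}$. Then the following are equivalent: (i) $x\perp_B y$. (ii) $0\in\operatorname{conv}\left\{\lim_{\mathcal{U}}\overline{x_n}y_n:\ \mathcal{U}\text{ an ultrafilter on }\mathbb{N}\text{ with }\lim_{\mathcal{U}}|x_n|=\|x\|\right\}$. (iii) $0$ lies in the convex hull of the union of the two sets $\{\overline{x_n}y_n: n\in\mathbb{N},\ |x_n|=\|x\|\}$ and $\{\lim_{k\to\infty}\overline{x_{n_k}}y_{n_k}:\ (n_k)_{k\in\mathbb{N}}\text{ is an increasing sequence in }\mathbb{N},\ \lim_{k\to\infty}|x_{n_k}|=\|x\|,\ (y_{n_k})\text{ converges as }k\to\infty\}$ (where in the second set the limit $\lim_{k\to\infty}\overline{x_{n_k}}y_{n_k}$ is taken whenever it exists).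
   Context: $\mathbb{K}$ is $\mathbb{R}$ or $\mathbb{C}$. $\ell_\infty$ is the space of bounded sequences in $\mathbb{K}$ with the supremum norm $\|\cdot\|$. In a normed space $\mathbb{X}$ over $\mathbb{K}$, $x\perp_B y$ (Birkhoff-James orthogonality) means $\|x+\lambda y\|\ge\|x\|$ for all $\lambda\in\mathbb{K}$. For an ultrafilter $\mathcal{U}$ on $\mathbb{N}$ and a bounded sequence $(z_n)$ in $\mathbb{K}$, $\lim_{\mathcal{U}}z_n$ is the unique $z\in\mathbb{K}$ such that $\{n:|z_n-z|<\epsilon\}\in\mathcal{U}$ for every $\epsilon>0$. $\operatorname{conv}$ denotes the convex hull. Increasing sequences of natural numbers are strictly increasing. *)

theory Defs
  imports "HOL-Analysis.Analysis" "Jordan_Normal_Form.Conjugate"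
begin

text \<open>
  Since \<^typ>\<open>nat\<close> carries the discrete topology, the type \<^typ>\<open>nat \<Rightarrow>\<^sub>C 'k::real_normed_field\<close>
  consists of all bounded sequences, and its library norm is the supremum norm.
  The library only provides the scalar multiplication by reals on it, so the one by elements
  of the ground field is added here.
\<close>

lemma range_apply_bcontfun_nat:
  "range (apply_bcontfun :: (nat \<Rightarrow>\<^sub>C 'k::metric_space) \<Rightarrow> nat \<Rightarrow> 'k) = {z. bounded (range z)}"
  by (simp add: type_definition.Rep_range[OF type_definition_bcontfun] bcontfun_def)

lemma norm_bcontfun_eq_SUP:
  fixes x :: "nat \<Rightarrow>\<^sub>C 'k::real_normed_vector"
  shows "norm x = (SUP n. norm (x n))"
  by (simp add: norm_bcontfun_def dist_bcontfun.rep_eq)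

definition scale_seq :: "'k::real_normed_field \<Rightarrow> (nat \<Rightarrow>\<^sub>C 'k) \<Rightarrow> (nat \<Rightarrow>\<^sub>C 'k)" where
  "scale_seq c x = Bcontfun (\<lambda>n. c * x n)"

lemma apply_scale_seq [simp]: "apply_bcontfun (scale_seq c x) n = c * x n"
proof -
  have "(\<lambda>n. c * x n) \<in> bcontfun"
    by (rule bcontfun_normI[where b = "norm c * norm x"])
      (auto simp: norm_mult intro!: mult_left_mono norm_bounded continuous_intros)
  then show ?thesis
    by (simp add: scale_seq_def Bcontfun_inverse)
qed

lemma scale_seq_real: "scale_seq (c::real) x = c *\<^sub>R x"
  by (rule bcontfun_eqI) simp

lemma vector_space_scale_seq: "vector_space scale_seq"
  by unfold_locales (auto intro!: bcontfun_eqI simp: algebra_simps)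

lemma norm_scale_seq: "norm (scale_seq c x) = norm c * norm x"
proof (rule antisym)
  show le: "norm (scale_seq c x) \<le> norm c * norm x" for c :: 'a and x
    by (rule norm_bound) (auto simp: norm_mult intro!: mult_left_mono norm_bounded)
  show "norm c * norm x \<le> norm (scale_seq c x)"
  proof (cases "c = 0")
    case False
    then have "scale_seq (inverse c) (scale_seq c x) = x"
      by (intro bcontfun_eqI) simp
    then have "norm x \<le> norm (inverse c) * norm (scale_seq c x)"
      using le[of "inverse c" "scale_seq c x"] by simp
    with False show ?thesis
      by (simp add: norm_inverse norm_divide field_simps)
  qed simp
qed

text \<open>The scalar multiplication is an argument because the type classes only know real scalars.\<close>

definition birkhoff_james_orthogonal ::
  "('k \<Rightarrow> 'v \<Rightarrow> 'v) \<Rightarrow> 'v::real_normed_vector \<Rightarrow> 'v \<Rightarrow> bool" where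
  "birkhoff_james_orthogonal sc x y \<longleftrightarrow> (\<forall>c. norm (x + sc c y) \<ge> norm x)"

text \<open>Principal ultrafilters are included.\<close>

definition ultrafilter :: "'a filter \<Rightarrow> bool" where
  "ultrafilter U \<longleftrightarrow> U \<noteq> bot \<and> (\<forall>P. eventually P U \<or> eventually (\<lambda>n. \<not> P n) U)"

text \<open>
  Below, \<^const>\<open>conjugate\<close> is the identity on \<^typ>\<open>real\<close> and \<^const>\<open>cnj\<close> on \<^typ>\<open>complex\<close>.
  The limit of a sequence along an ultrafilter is expressed by \<^const>\<open>filterlim\<close>: convergence
  of \<^term>\<open>z\<close> to \<^term>\<open>l\<close> along \<^term>\<open>U\<close> means that \<^term>\<open>{n. dist (z n) l < e}\<close> belongs
  to \<^term>\<open>U\<close> for every \<^term>\<open>e > 0\<close>.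
\<close>

definition ultrafilter_limits ::
  "(nat \<Rightarrow>\<^sub>C 'k::{real_normed_field, conjugatable_field}) \<Rightarrow> (nat \<Rightarrow>\<^sub>C 'k) \<Rightarrow> 'k set" where
  "ultrafilter_limits x y =
     {l. \<exists>U. ultrafilter U \<and> ((\<lambda>n. norm (x n)) \<longlongrightarrow> norm x) U \<and>
             ((\<lambda>n. conjugate (x n) * y n) \<longlongrightarrow> l) U}"

definition attained_products ::
  "(nat \<Rightarrow>\<^sub>C 'k::{real_normed_field, conjugatable_field}) \<Rightarrow> (nat \<Rightarrow>\<^sub>C 'k) \<Rightarrow> 'k set" where
  "attained_products x y = {conjugate (x n) * y n | n. norm (x n) = norm x}"

definition subsequence_limits ::
  "(nat \<Rightarrow>\<^sub>C 'k::{real_normed_field, conjugatable_field}) \<Rightarrow> (nat \<Rightarrow>\<^sub>C 'k) \<Rightarrow> 'k set" where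
  "subsequence_limits x y =
     {l. \<exists>r. strict_mono r \<and> (\<lambda>k. norm (x (r k))) \<longlonglongrightarrow> norm x \<and>
             convergent (\<lambda>k. y (r k)) \<and> (\<lambda>k. conjugate (x (r k)) * y (r k)) \<longlonglongrightarrow> l}"

end

theory Submission
  imports Defs
begin

text \<open>
  Write \<open>p\<^sub>n = conjugate (x\<^sub>n) y\<^sub>n\<close> and let \<open>C\<close> be the set of those \<open>l\<close> for which the point
  \<open>(\<parallel>x\<parallel>, l)\<close> lies in the closure of the points \<open>(|x\<^sub>n|, p\<^sub>n)\<close>. This set of values approached by
  \<open>p\<^sub>n\<close> where \<open>|x\<^sub>n|\<close> approaches \<open>\<parallel>x\<parallel>\<close> is what both descriptions in the theorem compute.
  On the one hand, a point of the closure of a range is the limit along some filter on the indices,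
  which extends to an ultrafilter. On the other hand, it is either a value of the sequence or an
  accumulation point, hence the limit of a subsequence, along which \<open>y\<close> may be assumed to converge
  by compactness. So \<open>C\<close> equals the set of ultrafilter limits
  (\<open>ultrafilter_limits_eq\<close>) and the union in the third condition
  (\<open>attained_products_Un_subsequence_limits\<close>).

  It remains to show that \<open>x\<close> is orthogonal to \<open>y\<close> iff \<open>0\<close> is in the convex hull of \<open>C\<close>
  (\<open>birkhoff_james_orthogonal_iff\<close>). Everything rests on the identity
  \<open>|x\<^sub>n + c y\<^sub>n|\<^sup>2 = |x\<^sub>n|\<^sup>2 + 2 \<langle>conjugate c, p\<^sub>n\<rangle> + |c|\<^sup>2 |y\<^sub>n|\<^sup>2\<close>, with the real inner product of the
  ground field. If some \<open>c\<close> makes the norm drop, then \<open>\<langle>conjugate c, p\<^sub>n\<rangle>\<close> is bounded above by a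
  negative constant near the indices where \<open>|x\<^sub>n|\<close> is almost \<open>\<parallel>x\<parallel>\<close>, so an open half-space that
  misses \<open>0\<close> contains \<open>C\<close>. Conversely, if \<open>0\<close> is not in the hull, which is compact, a functional
  \<open>\<langle>a, \<cdot>\<rangle>\<close> exceeds some \<open>b > 0\<close> on it. By compactness the indices with \<open>\<langle>a, p\<^sub>n\<rangle> \<le> b\<close> have
  \<open>|x\<^sub>n|\<close> bounded away from \<open>\<parallel>x\<parallel>\<close>. For small \<open>t > 0\<close> the vector \<open>x - t conjugate (a) y\<close> is
  then shorter than \<open>x\<close>: at these indices because it is a small perturbation, at the others
  because of the linear term in the identity.
\<close>

text \<open>
  The real and the complex numbers enter the proof only through this adjunction between
  multiplication and conjugation, so a class with these two instances treats both at once.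
\<close>

class conjugation_inner_field = real_normed_field + conjugatable_field + euclidean_space +
  assumes inner_mult_conjugate: "x \<bullet> (c * y) = conjugate c \<bullet> (conjugate x * y)"

instance real :: conjugation_inner_field
  by intro_classes simp

instance complex :: conjugation_inner_field
  by intro_classes (simp add: inner_complex_def algebra_simps)

lemma norm_conjugate:
  fixes x :: "'k::conjugation_inner_field"
  shows "norm (conjugate x) = norm x"
  using inner_mult_conjugate[of x x 1] by (simp add: norm_eq_sqrt_inner)

lemma norm_add_mult_squared:
  fixes x y c :: "'k::conjugation_inner_field"
  shows "(norm (x + c * y))\<^sup>2
    = (norm x)\<^sup>2 + 2 * (conjugate c \<bullet> (conjugate x * y)) + (norm c)\<^sup>2 * (norm y)\<^sup>2"
proof -
  have "(norm (x + c * y))\<^sup>2 = (norm x)\<^sup>2 + 2 * (x \<bullet> (c * y)) + (norm (c * y))\<^sup>2"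
    by (simp add: power2_norm_eq_inner inner_add inner_commute[of "c * y" x])
  then show ?thesis
    by (simp only: inner_mult_conjugate[of x c y] norm_mult power_mult_distrib)
qed

section \<open>Ultrafilters refining a filter\<close>

text \<open>
  Zorn's lemma gives a minimal proper filter below \<open>F\<close>. Minimality makes it an ultrafilter: if
  \<open>P\<close> holds frequently, then restricting the filter to \<open>P\<close> keeps it proper and so changes nothing.
\<close>

lemma ultrafilter_le_exists:
  fixes F :: "'a filter"
  assumes "F \<noteq> bot"
  obtains U where "ultrafilter U" "U \<le> F"
proof -
  define A where "A = {G. G \<noteq> bot \<and> G \<le> F}"
  have "\<exists>m\<in>A. \<forall>a\<in>A. a \<le> m \<longrightarrow> a = m"
  proof (rule predicate_Zorn)
    show "partial_order_on A (relation_of (\<lambda>a b. b \<le> a) A)"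
      by (rule partial_order_on_relation_ofI) auto
  next
    fix C assume C: "C \<in> Chains (relation_of (\<lambda>a b. b \<le> a) A)"
    then have CA: "C \<subseteq> A" and chain: "\<And>G H. G \<in> C \<Longrightarrow> H \<in> C \<Longrightarrow> G \<le> H \<or> H \<le> G"
      by (auto simp: Chains_def relation_of_def)
    show "\<exists>u\<in>A. \<forall>a\<in>C. u \<le> a"
    proof (cases "C = {}")
      case True
      with assms show ?thesis by (auto simp: A_def)
    next
      case False
      have "\<exists>G\<in>C. G \<le> inf H K" if "H \<in> C" "K \<in> C" for H K
        using chain[OF that] that by (metis inf.absorb1 inf.absorb2 order_refl)
      then have "eventually (\<lambda>_. False) (Inf C) \<longleftrightarrow> (\<exists>G\<in>C. eventually (\<lambda>_. False) G)"
        by (rule eventually_Inf_base[OF False])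
      then have "Inf C \<noteq> bot"
        using CA by (auto simp: trivial_limit_def[symmetric] A_def)
      moreover have "Inf C \<le> F"
        using False CA by (auto simp: A_def intro: Inf_lower2)
      ultimately show ?thesis
        by (auto simp: A_def intro: Inf_lower)
    qed
  qed
  then obtain U where U: "U \<noteq> bot" "U \<le> F"
    and min: "\<And>G. G \<noteq> bot \<Longrightarrow> G \<le> U \<Longrightarrow> G = U"
    unfolding A_def by (blast intro: order_trans)
  have "eventually P U" if "\<not> eventually (\<lambda>n. \<not> P n) U" for P
  proof -
    have "inf U (principal {n. P n}) \<noteq> bot"
      using that by (simp add: trivial_limit_def eventually_inf_principal)
    then have "inf U (principal {n. P n}) = U"
      by (intro min) auto
    moreover have "eventually P (inf U (principal {n. P n}))"
      by (simp add: eventually_inf_principal)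
    ultimately show ?thesis
      by simp
  qed
  with U that show ?thesis
    unfolding ultrafilter_def by blast
qed

text \<open>
  The neighbourhood filter of a point of the closure pulls back to a proper filter on the indices.
\<close>

lemma closure_range_iff_ultrafilter_limit:
  fixes f :: "'a \<Rightarrow> 'b::topological_space"
  shows "l \<in> closure (range f) \<longleftrightarrow> (\<exists>U. ultrafilter U \<and> (f \<longlongrightarrow> l) U)"
proof
  assume l: "l \<in> closure (range f)"
  have "filtercomap f (nhds l) \<noteq> bot"
  proof (rule filtercomap_neq_bot)
    fix P assume "eventually P (nhds l)"
    then obtain S where "open S" "l \<in> S" "\<forall>z\<in>S. P z"
      by (auto simp: eventually_nhds)
    moreover from this l have "S \<inter> range f \<noteq> {}"
      by (metis IntI empty_iff open_Int_closure_eq_empty)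
    ultimately show "\<exists>n. P (f n)" by blast
  qed
  then obtain U where "ultrafilter U" "U \<le> filtercomap f (nhds l)"
    by (rule ultrafilter_le_exists)
  then show "\<exists>U. ultrafilter U \<and> (f \<longlongrightarrow> l) U"
    by (auto simp: filterlim_def filtermap_le_iff_le_filtercomap)
next
  assume "\<exists>U. ultrafilter U \<and> (f \<longlongrightarrow> l) U"
  then obtain U where "U \<noteq> bot" "(f \<longlongrightarrow> l) U"
    by (auto simp: ultrafilter_def)
  then show "l \<in> closure (range f)"
    by (intro Lim_in_closed_set[of _ f U]) (simp_all add: subsetD[OF closure_subset])
qed

section \<open>Limits of the products along norming indices\<close>

definition moduli_and_products ::
  "(nat \<Rightarrow>\<^sub>C 'k::conjugation_inner_field) \<Rightarrow> (nat \<Rightarrow>\<^sub>C 'k) \<Rightarrow> nat \<Rightarrow> real \<times> 'k" where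
  "moduli_and_products x y n = (norm (x n), conjugate (x n) * y n)"

definition norming_limits ::
  "(nat \<Rightarrow>\<^sub>C 'k::conjugation_inner_field) \<Rightarrow> (nat \<Rightarrow>\<^sub>C 'k) \<Rightarrow> 'k set" where
  "norming_limits x y = {l. (norm x, l) \<in> closure (range (moduli_and_products x y))}"

lemma bounded_range_moduli_and_products: "bounded (range (moduli_and_products x y))"
proof -
  have "norm (moduli_and_products x y n) \<le> norm x + norm x * norm y" for n
  proof -
    have "norm (moduli_and_products x y n) \<le> norm (x n) + norm (x n) * norm (y n)"
      unfolding moduli_and_products_def
      using norm_Pair_le[of "norm (x n)" "conjugate (x n) * y n"]
      by (simp add: norm_mult norm_conjugate)
    also have "\<dots> \<le> norm x + norm x * norm y"
      by (intro add_mono mult_mono norm_bounded) auto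
    finally show ?thesis .
  qed
  then show ?thesis
    by (auto simp: bounded_iff)
qed

lemma compact_norming_limits: "compact (norming_limits x y)"
proof -
  have "compact (closure (range (moduli_and_products x y)) \<inter> ({norm x} \<times> UNIV))"
    by (intro compact_Int_closed closed_Times)
      (auto simp: bounded_range_moduli_and_products)
  then have "compact (snd ` (closure (range (moduli_and_products x y)) \<inter> ({norm x} \<times> UNIV)))"
    by (intro compact_continuous_image continuous_intros)
  also have "snd ` (closure (range (moduli_and_products x y)) \<inter> ({norm x} \<times> UNIV))
      = norming_limits x y"
    by (force simp: norming_limits_def)
  finally show ?thesis .
qed

lemma tendsto_moduli_and_products_iff:
  "(moduli_and_products x y \<longlongrightarrow> (s, l)) F \<longleftrightarrow>
    ((\<lambda>n. norm (x n)) \<longlongrightarrow> s) F \<and> ((\<lambda>n. conjugate (x n) * y n) \<longlongrightarrow> l) F"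
  unfolding moduli_and_products_def
  by (auto intro: tendsto_Pair dest: tendsto_fst tendsto_snd)

lemma ultrafilter_limits_eq: "ultrafilter_limits x y = norming_limits x y"
  by (auto simp: ultrafilter_limits_def norming_limits_def closure_range_iff_ultrafilter_limit
      tendsto_moduli_and_products_iff)

text \<open>
  A point of the closure of the range is a value, which gives an attained product, or a limit
  point of the range, which is the limit of a subsequence. Refining it makes \<open>y\<close> converge.
\<close>

lemma attained_products_Un_subsequence_limits:
  "attained_products x y \<union> subsequence_limits x y = norming_limits x y"
proof (intro equalityI subsetI)
  fix l assume "l \<in> attained_products x y \<union> subsequence_limits x y"
  then show "l \<in> norming_limits x y"
  proof
    assume "l \<in> attained_products x y"
    then have "(norm x, l) \<in> range (moduli_and_products x y)"
      by (force simp: attained_products_def moduli_and_products_def)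
    then show ?thesis
      unfolding norming_limits_def by (simp add: subsetD[OF closure_subset])
  next
    assume "l \<in> subsequence_limits x y"
    then obtain r where "(\<lambda>k. norm (x (r k))) \<longlonglongrightarrow> norm x"
        "(\<lambda>k. conjugate (x (r k)) * y (r k)) \<longlonglongrightarrow> l"
      by (auto simp: subsequence_limits_def)
    then have "(\<lambda>k. moduli_and_products x y (r k)) \<longlonglongrightarrow> (norm x, l)"
      unfolding moduli_and_products_def by (rule tendsto_Pair)
    then have "(norm x, l) \<in> closure (range (moduli_and_products x y))"
      by (intro Lim_in_closed_set[of _ "\<lambda>k. moduli_and_products x y (r k)" sequentially])
        (simp_all add: subsetD[OF closure_subset])
    then show ?thesis
      by (simp add: norming_limits_def)
  qed
next
  fix l assume l: "l \<in> norming_limits x y"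
  show "l \<in> attained_products x y \<union> subsequence_limits x y"
  proof (cases "(norm x, l) \<in> range (moduli_and_products x y)")
    case True
    then show ?thesis
      by (auto simp: attained_products_def moduli_and_products_def)
  next
    case False
    with l have "(norm x, l) islimpt range (moduli_and_products x y)"
      by (auto simp: norming_limits_def closure_def)
    then obtain r where r: "strict_mono r" "(moduli_and_products x y \<circ> r) \<longlonglongrightarrow> (norm x, l)"
      using islimpt_range_imp_convergent_subsequence by blast
    have "bounded (range (\<lambda>k. y (r k)))"
      unfolding bounded_iff using norm_bounded by blast
    then obtain q z where q: "strict_mono q" "((\<lambda>k. y (r k)) \<circ> q) \<longlonglongrightarrow> z"
      using bounded_imp_convergent_subsequence by blast
    have "((moduli_and_products x y \<circ> r) \<circ> q) \<longlonglongrightarrow> (norm x, l)"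
      using r(2) q(1) by (rule LIMSEQ_subseq_LIMSEQ)
    then have "(\<lambda>k. norm (x (r (q k)))) \<longlonglongrightarrow> norm x"
        "(\<lambda>k. conjugate (x (r (q k))) * y (r (q k))) \<longlonglongrightarrow> l"
      by (auto simp: moduli_and_products_def o_def dest: tendsto_fst tendsto_snd)
    moreover have "strict_mono (\<lambda>k. r (q k))"
      using strict_mono_o[OF r(1) q(1)] by (simp add: o_def)
    moreover have "convergent (\<lambda>k. y (r (q k)))"
      using q(2) by (auto simp: convergent_def o_def)
    ultimately show ?thesis
      unfolding subsequence_limits_def by blast
  qed
qed

section \<open>Orthogonality and the convex hull\<close>

text \<open>
  The closed set of limit points with \<open>a \<bullet> l \<le> b\<close> is compact and misses the fibre over \<open>norm x\<close>,
  so the first coordinate has a maximum \<open>s < norm x\<close> on it, unless the set is empty.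
\<close>

lemma modulus_bounded_away_if_separated:
  assumes sep: "\<And>l. l \<in> norming_limits x y \<Longrightarrow> b < a \<bullet> l"
  obtains s where "s < norm x"
    and "\<And>n. a \<bullet> (conjugate (x n) * y n) \<le> b \<Longrightarrow> norm (x n) \<le> s"
proof -
  define K where "K = closure (range (moduli_and_products x y)) \<inter> {z. a \<bullet> snd z \<le> b}"
  have range: "(norm (x n), conjugate (x n) * y n) \<in> K"
    if "a \<bullet> (conjugate (x n) * y n) \<le> b" for n
  proof -
    have "moduli_and_products x y n \<in> closure (range (moduli_and_products x y))"
      by (simp add: subsetD[OF closure_subset])
    with that show ?thesis
      by (simp add: K_def moduli_and_products_def)
  qed
  have "compact K"
    unfolding K_def
    by (intro compact_Int_closed closed_Collect_le continuous_intros)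
      (auto simp: bounded_range_moduli_and_products)
  show ?thesis
  proof (cases "K = {}")
    case True
    then show ?thesis
      using range by (intro that[of "norm x - 1"]) auto
  next
    case False
    with \<open>compact K\<close> have "\<exists>z\<in>K. \<forall>w\<in>K. fst w \<le> fst z"
      by (intro continuous_attains_sup continuous_intros)
    then obtain z where z: "z \<in> K" "\<And>w. w \<in> K \<Longrightarrow> fst w \<le> fst z"
      by blast
    have "closure (range (moduli_and_products x y)) \<subseteq> {..norm x} \<times> UNIV"
      by (intro closure_minimal closed_Times)
        (auto simp: moduli_and_products_def norm_bounded)
    then have "fst z \<le> norm x"
      using z(1) by (auto simp: K_def)
    moreover have "fst z \<noteq> norm x"
      using z(1) sep[of "snd z"] by (cases z) (auto simp: K_def norming_limits_def)
    ultimately have "fst z < norm x"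
      by simp
    moreover have "norm (x n) \<le> fst z" if "a \<bullet> (conjugate (x n) * y n) \<le> b" for n
      using z(2)[OF range[OF that]] by simp
    ultimately show ?thesis
      by (rule that)
  qed
qed

text \<open>
  A vector \<open>a\<close> that separates the hull from \<open>0\<close> is a direction of descent: subtracting a small
  positive multiple of \<open>conjugate a * y\<close> shortens \<open>x\<close>.
\<close>

lemma birkhoff_james_orthogonal_imp_zero_in_hull:
  fixes x y :: "nat \<Rightarrow>\<^sub>C 'k::conjugation_inner_field"
  assumes orth: "birkhoff_james_orthogonal scale_seq x y"
  shows "0 \<in> convex hull norming_limits x y"
proof (rule ccontr)
  assume "0 \<notin> convex hull norming_limits x y"
  then obtain a b where b: "0 < b" and "\<And>l. l \<in> convex hull norming_limits x y \<Longrightarrow> b < a \<bullet> l"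
    using separating_hyperplane_closed_0[OF convex_convex_hull
        compact_imp_closed[OF compact_convex_hull[OF compact_norming_limits]]]
    by blast
  then have "\<And>l. l \<in> norming_limits x y \<Longrightarrow> b < a \<bullet> l"
    by (simp add: hull_inc)
  then obtain s where s: "s < norm x"
    and away: "\<And>n. a \<bullet> (conjugate (x n) * y n) \<le> b \<Longrightarrow> norm (x n) \<le> s"
    using modulus_bounded_away_if_separated[of x y b a] by blast
  define A where "A = norm a * norm y"
  \<comment> \<open>The step is so small that the perturbation \<open>t A\<close> is below the gap \<open>norm x - s\<close>, and the
    quadratic term \<open>t\<^sup>2 A\<^sup>2\<close> is at most half the gain \<open>2 t b\<close> from the linear term.\<close>
  have "\<forall>\<^sub>F t in at_right 0. t * A < norm x - s"
    by (rule order_tendstoD(2)[where y = 0]) (use s in \<open>auto intro!: tendsto_eq_intros\<close>)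
  moreover have "\<forall>\<^sub>F t in at_right 0. t * A\<^sup>2 < b"
    by (rule order_tendstoD(2)[where y = 0]) (use b in \<open>auto intro!: tendsto_eq_intros\<close>)
  ultimately have "\<forall>\<^sub>F t in at_right 0. t * A < norm x - s \<and> t * A\<^sup>2 < b \<and> 0 < t"
    using eventually_at_right_less[of 0] by eventually_elim auto
  then obtain t where t: "t * A < norm x - s" "t * A\<^sup>2 < b" "0 < t"
    using eventually_happens' [OF trivial_limit_at_right_real] by blast
  define c where "c = conjugate (- (t *\<^sub>R a))"
  have c: "conjugate c = - (t *\<^sub>R a)"
    by (simp add: c_def)
  have norm_c: "norm c = t * norm a"
    using t(3) by (simp add: c_def norm_conjugate)
  define M where "M = max (s + t * A) (sqrt ((norm x)\<^sup>2 - t * b))"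
  have "norm (x n + c * y n) \<le> M" for n
  proof (cases "a \<bullet> (conjugate (x n) * y n) \<le> b")
    case True
    have "norm (x n + c * y n) \<le> norm (x n) + norm c * norm (y n)"
      by (metis norm_mult norm_triangle_ineq)
    also have "\<dots> \<le> s + norm c * norm y"
      by (intro add_mono mult_left_mono norm_bounded away True) auto
    finally show ?thesis
      by (simp add: M_def A_def norm_c mult.assoc)
  next
    case False
    have "(norm (x n + c * y n))\<^sup>2
        = (norm (x n))\<^sup>2 - 2 * (t * (a \<bullet> (conjugate (x n) * y n))) + (norm c)\<^sup>2 * (norm (y n))\<^sup>2"
      by (simp add: norm_add_mult_squared c)
    also have "\<dots> \<le> (norm x)\<^sup>2 - 2 * (t * b) + (norm c)\<^sup>2 * (norm y)\<^sup>2"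
      using False t(3)
      by (intro add_mono diff_mono mult_left_mono power_mono norm_bounded) auto
    also have "(norm c)\<^sup>2 * (norm y)\<^sup>2 = t * (t * A\<^sup>2)"
      by (simp add: norm_c A_def power2_eq_square)
    also have "\<dots> \<le> t * b"
      using t by (intro mult_left_mono) auto
    finally have "(norm (x n + c * y n))\<^sup>2 \<le> (norm x)\<^sup>2 - t * b"
      by (simp add: mult.commute)
    then have "norm (x n + c * y n) \<le> sqrt ((norm x)\<^sup>2 - t * b)"
      by (rule real_le_rsqrt)
    then show ?thesis
      by (simp add: M_def)
  qed
  then have "norm (x + scale_seq c y) \<le> M"
    by (intro norm_bound) simp
  also have "M < norm x"
  proof -
    have "sqrt ((norm x)\<^sup>2 - t * b) < sqrt ((norm x)\<^sup>2)"
      using t(3) b by (intro real_sqrt_less_mono) simp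
    then show ?thesis
      using t(1) by (simp add: M_def)
  qed
  finally show False
    using orth unfolding birkhoff_james_orthogonal_def by (metis not_le)
qed

text \<open>
  The norm of \<open>x + c y\<close> bounds its entries, and with the nonnegative quadratic term dropped
  this is a closed condition on the pairs \<open>(|x\<^sub>n|, conjugate (x\<^sub>n) y\<^sub>n)\<close>. It therefore
  passes to their closure, where it bounds the functional given by \<open>conjugate c\<close>.
\<close>

lemma birkhoff_james_orthogonal_if_zero_in_hull:
  fixes x y :: "nat \<Rightarrow>\<^sub>C 'k::conjugation_inner_field"
  assumes zero: "0 \<in> convex hull norming_limits x y"
  shows "birkhoff_james_orthogonal scale_seq x y"
  unfolding birkhoff_james_orthogonal_def
proof (rule allI, rule ccontr)
  fix c
  define m where "m = norm (x + scale_seq c y)"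
  assume "\<not> norm x \<le> norm (x + scale_seq c y)"
  then have m: "m < norm x" by (simp add: m_def)
  define S where "S = {z::real \<times> 'k. (fst z)\<^sup>2 + 2 * (conjugate c \<bullet> snd z) \<le> m\<^sup>2}"
  have "moduli_and_products x y n \<in> S" for n
  proof -
    have "(norm (x n))\<^sup>2 + 2 * (conjugate c \<bullet> (conjugate (x n) * y n)) \<le> (norm (x n + c * y n))\<^sup>2"
      by (simp add: norm_add_mult_squared)
    also have "\<dots> \<le> m\<^sup>2"
      using norm_bounded[of "x + scale_seq c y" n] by (intro power_mono) (auto simp: m_def)
    finally show ?thesis
      by (simp add: S_def moduli_and_products_def)
  qed
  moreover have "closed S"
    unfolding S_def by (intro closed_Collect_le continuous_intros)
  ultimately have "closure (range (moduli_and_products x y)) \<subseteq> S"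
    by (intro closure_minimal) auto
  moreover have "m\<^sup>2 < (norm x)\<^sup>2"
    using m by (intro power_strict_mono) (auto simp: m_def)
  ultimately have "norming_limits x y \<subseteq> {l. conjugate c \<bullet> l < 0}"
    by (force simp: norming_limits_def S_def)
  then have "convex hull norming_limits x y \<subseteq> {l. conjugate c \<bullet> l < 0}"
    by (intro hull_minimal convex_halfspace_lt)
  with zero show False by auto
qed

lemma birkhoff_james_orthogonal_iff:
  fixes x y :: "nat \<Rightarrow>\<^sub>C 'k::conjugation_inner_field"
  shows "birkhoff_james_orthogonal scale_seq x y \<longleftrightarrow> 0 \<in> convex hull norming_limits x y"
  by (rule iffI[OF birkhoff_james_orthogonal_imp_zero_in_hull
      birkhoff_james_orthogonal_if_zero_in_hull])

theorem theorem2p6: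
  fixes x y :: "nat \<Rightarrow>\<^sub>C real" and u v :: "nat \<Rightarrow>\<^sub>C complex"
  shows "((birkhoff_james_orthogonal scale_seq x y \<longleftrightarrow> 0 \<in> convex hull (ultrafilter_limits x y)) \<and>
          (birkhoff_james_orthogonal scale_seq x y \<longleftrightarrow>
             0 \<in> convex hull (attained_products x y \<union> subsequence_limits x y))) \<and>
         ((birkhoff_james_orthogonal scale_seq u v \<longleftrightarrow> 0 \<in> convex hull (ultrafilter_limits u v)) \<and>
          (birkhoff_james_orthogonal scale_seq u v \<longleftrightarrow>
             0 \<in> convex hull (attained_products u v \<union> subsequence_limits u v)))"
  unfolding birkhoff_james_orthogonal_iff ultrafilter_limits_eq
    attained_products_Un_subsequence_limits
  by (intro conjI refl)

end
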